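(* Let $A$ be a reflexive Banach space (of functions on $\mathbb{R}^N$) which is $\mathcal{D}_{\mathbb{Z}^N}$-cocompactly imbedded into $L^p(\mathbb{R}^N)$ for some $p>1$. Suppose that every weakly convergent sequence in $A$ has a subsequence which converges almost everywhere. Suppose furthermore that $A$ is $\mathbb{R}^N$-shift invariant and also rotation invariant, i.e. that $$\|u\circ\omega\|_A=\|u\|_A$$ for each $u\in A$ and for each $\omega:\mathbb{R}^N\to\mathbb{R}^N$ which is either a shift by some element of $\mathbb{R}^N$ or an element of $O(N)$. Let $A_R$ denote the subspace of radially symmetric functions in $A$. Then the imbedding of $A_R$ into $L^p(\mathbb{R}^N)$ is compact.
   Context: **Group.** $\mathcal{D}_{\mathbb{Z}^N}=\{g_y\}_{y\in\mathbb{Z}^N}$ with $g_yu=u(\cdot-y)$ (lattice shifts). **Cocompactness.** For a Banach space $A$ and a group $\mathcal{D}$ of continuous linear bijections of $A$, a sequence $\{u_k\}$ in $A$ is $\mathcal{D}$-weakly convergent to $u\in A$ if $g_k(u_k-u)\rightharpoonup0$ weakly in $A$ for every sequence $\{g_k\}$ in $\mathcal{D}$. A continuous imbedding of $A$ into a Banach space $B$ is $\mathcal{D}$-cocompact if every $\mathcal{D}$-weakly convergent sequence in $A$ converges in the norm of $B$. A function $u$ is radially symmetric if $u\circ\omega=u$ for every $\omega\in O(N)$.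
   Formalization: The formal theorem assumes N ≥ 2. For N = 1 the claim is false: A = H^1(R), p = 4 satisfies all hypotheses, but for an even bump function f the even functions f(x−k)+f(x+k) are bounded in A and have no subsequence converging in L^4. *)

theory Defs
  imports "HOL-Analysis.Analysis"
begin

definition Lp_space :: "'x measure \<Rightarrow> real \<Rightarrow> ('x \<Rightarrow> 'b::euclidean_space) set" where
  "Lp_space M p = {f \<in> borel_measurable M. integrable M (\<lambda>x. norm (f x) powr p)}"

definition Lp_norm :: "'x measure \<Rightarrow> real \<Rightarrow> ('x \<Rightarrow> 'b::euclidean_space) \<Rightarrow> real" where
  "Lp_norm M p f = (LINT x|M. norm (f x) powr p) powr (1 / p)"

definition Lp_convergent ::
    "'x measure \<Rightarrow> real \<Rightarrow> (nat \<Rightarrow> 'x \<Rightarrow> 'b::euclidean_space) \<Rightarrow> bool" where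
  "Lp_convergent M p F \<longleftrightarrow>
     (\<exists>f \<in> Lp_space M p. (\<lambda>k. Lp_norm M p (\<lambda>x. F k x - f x)) \<longlonglongrightarrow> 0)"

definition weakly_convergent_to :: "(nat \<Rightarrow> 'a::real_normed_vector) \<Rightarrow> 'a \<Rightarrow> bool" where
  "weakly_convergent_to u l \<longleftrightarrow>
     (\<forall>\<phi> :: 'a \<Rightarrow>\<^sub>L real. (\<lambda>k. blinfun_apply \<phi> (u k)) \<longlonglongrightarrow> blinfun_apply \<phi> l)"

text \<open>Reflexivity of the Banach space given by a type: the canonical map into the bidual is onto.\<close>

definition reflexive_space :: "'a::banach itself \<Rightarrow> bool" where
  "reflexive_space _ \<longleftrightarrow>
     (\<forall>\<Phi> :: ('a \<Rightarrow>\<^sub>L real) \<Rightarrow>\<^sub>L real. \<exists>u :: 'a. \<forall>\<phi>. blinfun_apply \<Phi> \<phi> = blinfun_apply \<phi> u)"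

definition D_weakly_convergent_to ::
    "('a::real_normed_vector \<Rightarrow> 'a) set \<Rightarrow> (nat \<Rightarrow> 'a) \<Rightarrow> 'a \<Rightarrow> bool" where
  "D_weakly_convergent_to D u l \<longleftrightarrow>
     (\<forall>g. (\<forall>k. g k \<in> D) \<longrightarrow> weakly_convergent_to (\<lambda>k. g k (u k - l)) 0)"

text \<open>
  A Banach space of (classes of a.e. equal) functions is a Banach space type \<open>'a\<close> together with
  a map \<open>J\<close> sending each element \<open>u\<close> to a representative \<open>J u\<close> of the class it stands for.
  Linearity and injectivity hold modulo null sets, so nothing below depends on the
  choice of representatives. Values are in a type \<open>'b\<close> of sort
  \<open>{euclidean_space, real_normed_field}\<close>, which stands for the scalar field (real or complex
  numbers). A complex space is regarded as a real one; this changes neither weak convergence nor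
  reflexivity.
\<close>

definition function_space ::
    "('a::real_normed_vector \<Rightarrow> 'n::euclidean_space \<Rightarrow> 'b::{euclidean_space,real_normed_field}) \<Rightarrow> bool"
  where
  "function_space J \<longleftrightarrow>
     (\<forall>u. J u \<in> borel_measurable lebesgue) \<and>
     (\<forall>u v. AE x in lebesgue. J (u + v) x = J u x + J v x) \<and>
     (\<forall>c u. AE x in lebesgue. J (c *\<^sub>R u) x = c *\<^sub>R J u x) \<and>
     (\<forall>u. (AE x in lebesgue. J u x = 0) \<longrightarrow> u = 0)"

definition continuously_imbedded_Lp ::
    "('a::real_normed_vector \<Rightarrow> 'n::euclidean_space \<Rightarrow> 'b::{euclidean_space,real_normed_field}) \<Rightarrow>
     real \<Rightarrow> bool" where
  "continuously_imbedded_Lp J p \<longleftrightarrow>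
     (\<forall>u. J u \<in> Lp_space lebesgue p) \<and> (\<exists>C. \<forall>u. Lp_norm lebesgue p (J u) \<le> C * norm u)"

definition cocompactly_imbedded_Lp ::
    "('a::real_normed_vector \<Rightarrow> 'a) set \<Rightarrow>
     ('a \<Rightarrow> 'n::euclidean_space \<Rightarrow> 'b::{euclidean_space,real_normed_field}) \<Rightarrow> real \<Rightarrow> bool" where
  "cocompactly_imbedded_Lp D J p \<longleftrightarrow>
     continuously_imbedded_Lp J p \<and>
     (\<forall>u l. D_weakly_convergent_to D u l \<longrightarrow> Lp_convergent lebesgue p (\<lambda>k. J (u k)))"

text \<open>The restriction of the imbedding to \<open>S\<close> maps bounded sequences to sequences with an
  \<open>L\<^sup>p\<close>-convergent subsequence.\<close>

definition compactly_imbedded_Lp ::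
    "'a::real_normed_vector set \<Rightarrow>
     ('a \<Rightarrow> 'n::euclidean_space \<Rightarrow> 'b::{euclidean_space,real_normed_field}) \<Rightarrow> real \<Rightarrow> bool" where
  "compactly_imbedded_Lp S J p \<longleftrightarrow>
     (\<forall>u. (\<forall>k. u k \<in> S) \<and> bounded (range u) \<longrightarrow>
        (\<exists>r :: nat \<Rightarrow> nat. strict_mono r \<and> Lp_convergent lebesgue p (\<lambda>k. J (u (r k)))))"

text \<open>The operators \<open>g\<^sub>y u = u(\<cdot> - y)\<close> with \<open>y\<close> a lattice point. On a shift-invariant space each
  lattice point gives exactly one such operator, because \<open>J\<close> is injective.\<close>

definition lattice_shifts ::
    "('a::real_normed_vector \<Rightarrow> real ^ 'n::finite \<Rightarrow> 'b::{euclidean_space,real_normed_field}) \<Rightarrow>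
     ('a \<Rightarrow> 'a) set" where
  "lattice_shifts J =
     {g. \<exists>y. (\<forall>i. y $ i \<in> \<int>) \<and> (\<forall>u. AE x in lebesgue. J (g u) x = J u (x - y))}"

definition invariant_under ::
    "('a::real_normed_vector \<Rightarrow> 'n::euclidean_space \<Rightarrow> 'b::{euclidean_space,real_normed_field}) \<Rightarrow>
     ('n \<Rightarrow> 'n) \<Rightarrow> bool" where
  "invariant_under J \<omega> \<longleftrightarrow>
     (\<forall>u. \<exists>v. (AE x in lebesgue. J v x = J u (\<omega> x)) \<and> norm v = norm u)"

definition radial_subspace ::
    "('a::real_normed_vector \<Rightarrow> 'n::euclidean_space \<Rightarrow> 'b::{euclidean_space,real_normed_field}) \<Rightarrow>
     'a set" where
  "radial_subspace J =
     {u. \<forall>\<omega>. orthogonal_transformation \<omega> \<longrightarrow> (AE x in lebesgue. J u (\<omega> x) = J u x)}"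

end

theory Submission
  imports Defs
begin

text \<open>
  The functionals \<open>u \<mapsto> \<integral>\<^sub>S u \<bullet> e\<close> for a suitable countable family of bounded sets \<open>S\<close> separate the
  points of the space. By reflexivity and Tychonov's theorem, they therefore detect weak convergence
  of bounded sequences, and a bounded sequence of radial functions has a weakly convergent subsequence
  \<open>u\<^sub>k\<close> with radial limit \<open>u\<close>.

  Let \<open>v\<^sub>k = u\<^sub>k - u\<close>. If \<open>\<bar>y\<bar>\<close> is large, then the sphere of radius \<open>\<bar>y\<bar>\<close> contains the centres of many
  disjoint balls of a given radius, and a radial \<open>v\<close> has the same \<open>L\<^sup>p\<close> mass on each of them.
  Hence \<open>v\<^sub>k(\<cdot> - y\<^sub>k)\<close> tends to zero in \<open>L\<^sup>p\<close> on bounded sets if \<open>\<bar>y\<^sub>k\<bar> \<rightarrow> \<infinity>\<close>, while bounded lattice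
  shifts take finitely many values. So \<open>v\<^sub>k(\<cdot> - y\<^sub>k)\<close> converges weakly to zero for all lattice
  points \<open>y\<^sub>k\<close>, and cocompactness applies.
\<close>

section \<open>Isometries and Lebesgue measure\<close>

lemma vimage_isometry_ball:
  fixes T :: "'a::metric_space \<Rightarrow> 'a"
  assumes iso: "\<And>x y. dist (T x) (T y) = dist x y" and surj: "surj T"
  shows "T -` ball a r = ball (inv T a) r"
proof -
  have "dist a (T x) = dist (inv T a) x" for x
    using iso[of "inv T a" x] surj_f_inv_f[OF surj] by simp
  then show ?thesis by auto
qed

lemma emeasure_lborel_ball_eq:
  "emeasure lborel (ball (a::'a::euclidean_space) r) = emeasure lborel (ball (b::'a) r)"
  by (cases "r \<ge> 0") (simp_all add: emeasure_ball ball_empty)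

text \<open>By Vitali's covering theorem, \<open>U\<close> is a disjoint union of countably many
  balls up to a null set. Their preimages are disjoint balls of the same radii inside the preimage
  of \<open>U\<close>. The inverse isometry will give the reverse inequality.\<close>

lemma emeasure_le_vimage_isometry:
  fixes T :: "'a::euclidean_space \<Rightarrow> 'a"
  assumes iso: "\<And>x y. dist (T x) (T y) = dist x y" and surj: "surj T" and U: "open U"
  shows "emeasure lborel U \<le> emeasure lborel (T -` U)"
proof -
  let ?K = "{(a, r). ball a r \<subseteq> U}"
  \<comment> \<open>Vitali's theorem asks for balls of arbitrarily small radius around each point:
    \<open>e\<close> keeps the ball inside \<open>U\<close>, and \<open>d/2\<close> makes the radius
    strictly smaller than \<open>d\<close>.\<close>
  have "\<exists>i. i \<in> ?K \<and> x \<in> ball (fst i) (snd i) \<and> snd i < d" if "x \<in> U" "0 < d" for x d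
  proof -
    obtain e where "e > 0" "ball x e \<subseteq> U" using U \<open>x \<in> U\<close> by (meson openE)
    then have "ball x (min e (d/2)) \<subseteq> U" by auto
    then show ?thesis using \<open>e > 0\<close> \<open>0 < d\<close>
      by (intro exI[of _ "(x, min e (d/2))"]) auto
  qed
  then obtain C where C: "countable C" "C \<subseteq> ?K"
    and disj: "pairwise (\<lambda>i j. disjnt (ball (fst i) (snd i)) (ball (fst j) (snd j))) C"
    and neg: "negligible (U - (\<Union>i\<in>C. ball (fst i) (snd i)))"
    using Vitali_covering_theorem_balls[of U ?K fst snd] by blast
  let ?B = "\<lambda>i::'a \<times> real. ball (fst i) (snd i)"
  let ?N = "U - (\<Union>i\<in>C. ?B i)"
  have open_C: "open (\<Union>i\<in>C. ?B i)" by auto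
  have meas: "?N \<in> sets lborel"
    using U open_C by auto
  then have N0: "emeasure lborel ?N = 0"
    using neg by (simp add: negligible_iff_null_sets null_sets_def)
  have df: "disjoint_family_on ?B C"
    using disj by (auto simp: disjoint_family_on_def pairwise_def disjnt_def)
  have dft: "disjoint_family_on (\<lambda>i. T -` ?B i) C"
    using df unfolding disjoint_family_on_def by blast
  have B: "T -` ?B i = ball (inv T (fst i)) (snd i)" for i
    using vimage_isometry_ball[OF iso surj] .
  have "emeasure lborel U \<le> emeasure lborel (?N \<union> (\<Union>i\<in>C. ?B i))"
    using U open_C by (intro emeasure_mono) (auto intro!: borel_open)
  also have "\<dots> \<le> emeasure lborel ?N + emeasure lborel (\<Union>i\<in>C. ?B i)"
    using meas open_C by (intro emeasure_subadditive) auto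
  also have "\<dots> = emeasure lborel (\<Union>i\<in>C. ?B i)" by (simp add: N0)
  also have "\<dots> = (\<integral>\<^sup>+ i. emeasure lborel (?B i) \<partial>count_space C)"
    using C df by (intro emeasure_UN_countable) auto
  also have "\<dots> = (\<integral>\<^sup>+ i. emeasure lborel (T -` ?B i) \<partial>count_space C)"
    unfolding B by (intro nn_integral_cong emeasure_lborel_ball_eq)
  also have "\<dots> = emeasure lborel (\<Union>i\<in>C. T -` ?B i)"
    using C dft by (intro emeasure_UN_countable[symmetric]) (auto simp: B)
  also have "\<dots> \<le> emeasure lborel (T -` U)"
  proof (rule emeasure_mono)
    have "open (T -` U)"
      using U iso by (intro open_vimage) (auto simp: continuous_on_iff)
    then show "T -` U \<in> sets lborel" by simp
  qed (use C(2) in fastforce)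
  finally show ?thesis .
qed

text \<open>The inequality for open sets, applied to \<open>T\<close> and to \<open>inv T\<close>,
  gives equality on open sets. Open boxes then identify the image measure as Lebesgue
  measure.\<close>

lemma distr_lborel_isometry:
  fixes T :: "'a::euclidean_space \<Rightarrow> 'a"
  assumes iso: "\<And>x y. dist (T x) (T y) = dist x y" and surj: "surj T"
  shows "distr lborel lborel T = lborel"
proof -
  have cont: "continuous_on UNIV T" using iso by (auto simp: continuous_on_iff)
  then have [measurable]: "T \<in> borel_measurable borel" by (rule borel_measurable_continuous_onI)
  have bij: "bij T"
    using surj iso by (metis bijI injI dist_eq_0_iff)
  have inviso: "dist (inv T x) (inv T y) = dist x y" for x y
    using iso[of "inv T x" "inv T y"] surj_f_inv_f[OF surj] by simp
  have *: "emeasure lborel (T -` U) = emeasure lborel U" if "open U" for U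
  proof (rule antisym)
    have "open (T -` U)" using cont that by (rule open_vimage[rotated])
    then have "emeasure lborel (T -` U) \<le> emeasure lborel (inv T -` (T -` U))"
      using inviso bij bij_imp_bij_inv bij_is_surj
      by (intro emeasure_le_vimage_isometry) blast+
    also have "inv T -` (T -` U) = U"
      using surj_f_inv_f[OF surj] by auto
    finally show "emeasure lborel (T -` U) \<le> emeasure lborel U" .
  qed (use emeasure_le_vimage_isometry[OF iso surj that] in auto)
  show ?thesis
  proof (rule lborel_eqI[symmetric])
    fix l u :: 'a
    assume "\<And>b. b \<in> Basis \<Longrightarrow> l \<bullet> b \<le> u \<bullet> b"
    then show "emeasure (distr lborel lborel T) (box l u) = (\<Prod>b\<in>Basis. (u - l) \<bullet> b)"
      using *[OF open_box, of l u] emeasure_lborel_box[of l u] by (simp add: emeasure_distr)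
  qed simp
qed

text \<open>Since \<open>T\<close> preserves \<open>lborel\<close>, preimages of null sets are null
  sets, so both facts pass to the completion. Rotations and translations are treated together in
  this way.\<close>

lemma lebesgue_isometry:
  fixes T :: "'a::euclidean_space \<Rightarrow> 'a"
  assumes iso: "\<And>x y. dist (T x) (T y) = dist x y" and surj: "surj T"
  shows "T \<in> lebesgue \<rightarrow>\<^sub>M lebesgue"
    and "distr lebesgue lebesgue T = lebesgue"
proof -
  have "continuous_on UNIV T" using iso by (auto simp: continuous_on_iff)
  then have T: "T \<in> lborel \<rightarrow>\<^sub>M lborel"
    using borel_measurable_continuous_onI by simp
  then have T': "T \<in> lebesgue \<rightarrow>\<^sub>M lborel" by (rule measurable_completion)
  have d: "distr lebesgue lborel T = lborel"
    using distr_completion[OF T] distr_lborel_isometry[OF assms] by simp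
  show "T \<in> lebesgue \<rightarrow>\<^sub>M lebesgue"
    by (rule completion.measurable_completion2[OF T']) (simp add: d)
  show "distr lebesgue lebesgue T = lebesgue"
    using completion.completion_distr_eq[OF T'] d by simp
qed

section \<open>Weak convergence in reflexive spaces\<close>

text \<open>A filter version of passing to a convergent subnet: \<open>F\<close> is refined by the
  preimages of the neighbourhoods of a cluster point of its image filter.\<close>

lemma filter_cluster_point:
  assumes "compact K" "F \<noteq> bot" "\<And>k. f k \<in> K"
  obtains x G where "G \<noteq> bot" "G \<le> F" "(f \<longlongrightarrow> x) G"
proof -
  have "filtermap f F \<noteq> bot" using assms by (simp add: filtermap_bot_iff)
  moreover have "eventually (\<lambda>x. x \<in> K) (filtermap f F)" using assms by (simp add: eventually_filtermap)
  ultimately obtain x where x: "inf (nhds x) (filtermap f F) \<noteq> bot"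
    using assms(1) unfolding compact_filter by blast
  let ?G = "inf (filtercomap f (nhds x)) F"
  have "?G \<noteq> bot"
  proof
    assume "?G = bot"
    \<comment> \<open>If the refined filter were trivial, some neighbourhood \<open>R\<close> of
      \<open>x\<close> would be avoided by \<open>f\<close> eventually along \<open>F\<close>, so
      \<open>x\<close> would not be a cluster point.\<close>
    then have "eventually (\<lambda>_. False) ?G" by simp
    then obtain P Q R where "eventually Q F" "eventually R (nhds x)"
      "\<And>y. R (f y) \<Longrightarrow> P y" "\<And>y. P y \<Longrightarrow> Q y \<Longrightarrow> False"
      unfolding eventually_inf eventually_filtercomap by blast
    then have "eventually (\<lambda>_. False) (inf (nhds x) (filtermap f F))"
      unfolding eventually_inf eventually_filtermap
      by (intro exI[of _ R] exI[of _ "\<lambda>y. \<not> R y"]) (auto elim!: eventually_mono)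
    with x show False by (simp add: trivial_limit_def)
  qed
  moreover have "(f \<longlongrightarrow> x) ?G"
    by (simp add: filterlim_iff_le_filtercomap)
  ultimately show thesis using that[of ?G x] by simp
qed

lemma compact_Pi_UNIV:
  fixes S :: "'i \<Rightarrow> 'b::topological_space set"
  assumes "\<And>i. compact (S i)"
  shows "compact (Pi UNIV S)"
proof -
  have "compactin (product_topology (\<lambda>i. euclidean) UNIV) (PiE UNIV S)"
    unfolding compactin_PiE using assms by simp
  then show ?thesis
    by (simp add: euclidean_product_topology PiE_UNIV_domain Pi_def)
qed

lemma tendsto_fun_component:
  fixes f :: "'k \<Rightarrow> 'i \<Rightarrow> 'b::topological_space"
  assumes "(f \<longlongrightarrow> X) F"
  shows "((\<lambda>k. f k i) \<longlongrightarrow> X i) F"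
proof (rule topological_tendstoI)
  fix S :: "'b set" assume "open S" "X i \<in> S"
  moreover have "open ((\<lambda>x::'i \<Rightarrow> 'b. x i) -` S)"
    using \<open>open S\<close> by (intro open_vimage continuous_on_product_coordinates)
  ultimately show "eventually (\<lambda>k. f k i \<in> S) F"
    using topological_tendstoD[OF assms, of "(\<lambda>x. x i) -` S"] by simp
qed

text \<open>This is the Banach-Alaoglu argument in the bidual. The evaluations at \<open>z k\<close>
  lie in a product of compact intervals, so they have a pointwise limit along a finer filter. The
  limit is linear and bounded, hence by reflexivity it is evaluation at some
  \<open>w\<close>.\<close>

lemma reflexive_weak_cluster_point:
  fixes z :: "nat \<Rightarrow> 'a::banach"
  assumes refl: "reflexive_space TYPE('a)" and bdd: "bounded (range z)" and F: "F \<noteq> bot"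
  shows "\<exists>w G. G \<noteq> bot \<and> G \<le> F \<and>
    (\<forall>\<phi>::'a \<Rightarrow>\<^sub>L real. ((\<lambda>k. blinfun_apply \<phi> (z k)) \<longlongrightarrow> blinfun_apply \<phi> w) G)"
proof -
  obtain C where C: "\<And>k. norm (z k) \<le> C" using bdd by (auto simp: bounded_iff)
  define f where "f k = (\<lambda>\<phi>::'a \<Rightarrow>\<^sub>L real. blinfun_apply \<phi> (z k))" for k
  have f_bd: "\<bar>f k \<phi>\<bar> \<le> norm \<phi> * C" for k \<phi>
    using norm_blinfun[of \<phi> "z k"] mult_left_mono[OF C norm_ge_zero, of \<phi> k]
    unfolding f_def by simp
  obtain X G where G: "G \<noteq> bot" "G \<le> F" and X: "(f \<longlongrightarrow> X) G"
  proof (rule filter_cluster_point)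
    show "compact (Pi UNIV (\<lambda>\<phi>::'a \<Rightarrow>\<^sub>L real. cball (0::real) (norm \<phi> * C)))"
      by (rule compact_Pi_UNIV) simp
    show "f k \<in> Pi UNIV (\<lambda>\<phi>. cball 0 (norm \<phi> * C))" for k
      using f_bd by (simp add: Pi_def)
  qed (use F in auto)
  have lim: "((\<lambda>k. f k \<phi>) \<longlongrightarrow> X \<phi>) G" for \<phi>
    using X by (rule tendsto_fun_component)
  have "bounded_linear X"
  proof (rule bounded_linear_intro)
    show "X (\<phi> + \<psi>) = X \<phi> + X \<psi>" for \<phi> \<psi>
    proof (rule tendsto_unique[OF G(1)])
      show "((\<lambda>k. f k (\<phi> + \<psi>)) \<longlongrightarrow> X \<phi> + X \<psi>) G"
        using tendsto_add[OF lim lim, of \<phi> \<psi>] by (simp add: f_def blinfun.add_left)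
    qed (rule lim)
    show "X (c *\<^sub>R \<phi>) = c *\<^sub>R X \<phi>" for c \<phi>
    proof (rule tendsto_unique[OF G(1)])
      show "((\<lambda>k. f k (c *\<^sub>R \<phi>)) \<longlongrightarrow> c *\<^sub>R X \<phi>) G"
        using tendsto_scaleR[OF tendsto_const lim, of c \<phi>] by (simp add: f_def blinfun.scaleR_left)
    qed (rule lim)
    show "norm (X \<phi>) \<le> norm \<phi> * C" for \<phi>
      by (rule tendsto_upperbound[OF tendsto_norm[OF lim] _ G(1)]) (use f_bd in auto)
  qed
  then have "\<And>\<phi>. blinfun_apply (Blinfun X) \<phi> = X \<phi>" by (simp add: bounded_linear_Blinfun_apply)
  moreover obtain w where "\<And>\<phi>. blinfun_apply (Blinfun X) \<phi> = blinfun_apply \<phi> w"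
    using refl unfolding reflexive_space_def by blast
  ultimately have "X \<phi> = blinfun_apply \<phi> w" for \<phi> by simp
  then have "\<forall>\<phi>::'a \<Rightarrow>\<^sub>L real. ((\<lambda>k. blinfun_apply \<phi> (z k)) \<longlongrightarrow> blinfun_apply \<phi> w) G"
    using lim unfolding f_def by simp
  with G show ?thesis by blast
qed

text \<open>Every weak cluster point of \<open>z\<close> agrees with \<open>w\<close> on the total
  family, hence equals \<open>w\<close>. A bounded sequence with only one possible weak cluster
  point converges weakly to it.\<close>

lemma weakly_convergent_to_of_total:
  fixes z :: "nat \<Rightarrow> 'a::banach" and l :: "'i \<Rightarrow> 'a \<Rightarrow>\<^sub>L real"
  assumes refl: "reflexive_space TYPE('a)" and bdd: "bounded (range z)"
    and total: "\<And>u. (\<And>i. i \<in> I \<Longrightarrow> blinfun_apply (l i) u = 0) \<Longrightarrow> u = 0"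
    and lim: "\<And>i. i \<in> I \<Longrightarrow> (\<lambda>k. blinfun_apply (l i) (z k)) \<longlonglongrightarrow> blinfun_apply (l i) w"
  shows "weakly_convergent_to z w"
  unfolding weakly_convergent_to_def
proof (intro allI tendstoI)
  fix \<phi> :: "'a \<Rightarrow>\<^sub>L real" and e :: real
  assume "e > 0"
  show "\<forall>\<^sub>F k in sequentially. dist (\<phi> (z k)) (\<phi> w) < e"
  proof (rule ccontr)
    let ?P = "\<lambda>k. dist (\<phi> (z k)) (\<phi> w) < e"
    \<comment> \<open>The tails restricted to the bad indices form a proper filter, because
      \<open>?P\<close> does not hold eventually. A weak cluster point along it would have to be
      \<open>w\<close>, where \<open>?P\<close> does hold.\<close>
    let ?F = "inf sequentially (principal {k. \<not> ?P k})"
    assume "\<not> eventually ?P sequentially"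
    then have "?F \<noteq> bot" unfolding trivial_limit_def eventually_inf_principal by simp
    from reflexive_weak_cluster_point[OF refl bdd this]
    obtain v G where vG: "G \<noteq> bot \<and> G \<le> ?F \<and>
        (\<forall>\<psi>::'a \<Rightarrow>\<^sub>L real. ((\<lambda>k. \<psi> (z k)) \<longlongrightarrow> \<psi> v) G)"
      by (elim exE)
    then have G: "G \<noteq> bot" "G \<le> ?F" by simp_all
    have v: "((\<lambda>k. \<psi> (z k)) \<longlongrightarrow> \<psi> v) G" for \<psi> :: "'a \<Rightarrow>\<^sub>L real" using vG by simp
    have "l i v = l i w" if "i \<in> I" for i
    proof (rule tendsto_unique[OF G(1) v])
      show "((\<lambda>k. l i (z k)) \<longlongrightarrow> l i w) G"
        using lim[OF that] G(2) by (meson le_inf_iff tendsto_mono)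
    qed
    then have "v - w = 0" by (intro total) (simp add: blinfun.diff_right)
    then have "eventually ?P G" using tendstoD[OF v[of \<phi>] \<open>e > 0\<close>] by simp
    moreover have "eventually (\<lambda>k. \<not> ?P k) G"
      using G(2) by (rule filter_leD) (simp add: eventually_inf_principal)
    ultimately have "eventually (\<lambda>_. False) G" by eventually_elim simp
    with G(1) show False by (simp add: trivial_limit_def)
  qed
qed

text \<open>For countably many functionals the product of intervals is metrizable, so compactness
  yields a subsequence along which all of them converge. A weak cluster point \<open>w\<close> of
  this subsequence identifies the limits as values at \<open>w\<close>, and totality upgrades this
  to weak convergence.\<close>

lemma weakly_convergent_subsequence_of_total:
  fixes z :: "nat \<Rightarrow> 'a::banach" and l :: "'i \<Rightarrow> 'a \<Rightarrow>\<^sub>L real"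
  assumes refl: "reflexive_space TYPE('a)" and bdd: "bounded (range z)"
    and countable: "countable I"
    and total: "\<And>u. (\<And>i. i \<in> I \<Longrightarrow> blinfun_apply (l i) u = 0) \<Longrightarrow> u = 0"
  obtains r w where "strict_mono (r :: nat \<Rightarrow> nat)" "weakly_convergent_to (\<lambda>k. z (r k)) w"
proof -
  obtain C where C: "\<And>k. norm (z k) \<le> C" using bdd by (auto simp: bounded_iff)
  \<comment> \<open>The enumeration may repeat indices, and its values are arbitrary if
    \<open>I\<close> is empty. This is harmless, since it only has to reach every index in
    \<open>I\<close>.\<close>
  define m where "m n = l (from_nat_into I n)" for n
  define f where "f k n = blinfun_apply (m n) (z k)" for k n
  have "compact (Pi UNIV (\<lambda>n. cball (0::real) (norm (m n) * C)))"
    by (rule compact_Pi_UNIV) simp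
  moreover have "f k \<in> Pi UNIV (\<lambda>n. cball 0 (norm (m n) * C))" for k
  proof -
    have "\<bar>f k n\<bar> \<le> norm (m n) * C" for n
      using norm_blinfun[of "m n" "z k"] mult_left_mono[OF C norm_ge_zero, of "m n" k]
      unfolding f_def by simp
    then show ?thesis by (simp add: Pi_def)
  qed
  ultimately obtain X r where r: "strict_mono (r :: nat \<Rightarrow> nat)" and X: "(f \<circ> r) \<longlonglongrightarrow> X"
    unfolding compact_eq_seq_compact_metric seq_compact_def by blast
  have bdd_r: "bounded (range (\<lambda>k. z (r k)))"
    using C by (auto simp: bounded_iff)
  from reflexive_weak_cluster_point[OF refl bdd_r sequentially_bot]
  obtain w G where wG: "G \<noteq> bot \<and> G \<le> sequentially \<and>
      (\<forall>\<psi>::'a \<Rightarrow>\<^sub>L real. ((\<lambda>k. \<psi> (z (r k))) \<longlongrightarrow> \<psi> w) G)"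
    by (elim exE)
  then have G: "G \<noteq> bot" "G \<le> sequentially" by simp_all
  have w: "((\<lambda>k. \<psi> (z (r k))) \<longlongrightarrow> \<psi> w) G" for \<psi> :: "'a \<Rightarrow>\<^sub>L real" using wG by simp
  have "(\<lambda>k. l i (z (r k))) \<longlonglongrightarrow> l i w" if i: "i \<in> I" for i
  proof -
    obtain n where n: "l i = m n"
      unfolding m_def using from_nat_into_surj[OF countable i] by metis
    have L: "(\<lambda>k. m n (z (r k))) \<longlonglongrightarrow> X n"
      using tendsto_fun_component[OF X, of n] by (simp add: f_def)
    then have "((\<lambda>k. m n (z (r k))) \<longlongrightarrow> X n) G"
      using G(2) tendsto_mono by blast
    then have "X n = m n w" by (rule tendsto_unique[OF G(1) _ w])
    with L n show ?thesis by simp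
  qed
  then have "weakly_convergent_to (\<lambda>k. z (r k)) w"
    by (intro weakly_convergent_to_of_total[OF refl bdd_r total])
  with r that show thesis by blast
qed

section \<open>Functions determined by their integrals\<close>

text \<open>The sets over which \<open>f\<close> integrates to zero form a Dynkin system containing
  the intersection-stable generator, hence they are all measurable sets. Splitting by the sign of
  \<open>f\<close> then shows that the integral of \<open>\<bar>f x\<bar>\<close> vanishes.\<close>

lemma AE_zero_of_set_integral_zero_generator:
  fixes f :: "'x \<Rightarrow> real"
  assumes f: "integrable M f"
    and gen: "sets M = sigma_sets (space M) B" and int: "Int_stable B" and B: "space M \<in> B"
    and zero: "\<And>E. E \<in> B \<Longrightarrow> (LINT x:E|M. f x) = 0"
  shows "AE x in M. f x = 0"
proof -
  have [measurable]: "f \<in> borel_measurable M" using f by simp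
  have "B \<subseteq> sets M" unfolding gen by auto
  then have pow: "B \<subseteq> Pow (space M)" using sets.sets_into_space by blast
  have si: "set_integrable M E f" if "E \<in> sets M" for E
    unfolding set_integrable_def using that f by (rule integrable_mult_indicator)
  have all: "(LINT x:E|M. f x) = 0" if "E \<in> sigma_sets (space M) B" for E
    using int pow that
  proof (induction rule: sigma_sets_induct_disjoint)
    case (compl A)
    then have A: "A \<in> sets M" by (simp add: gen)
    have "(LINT x:space M|M. f x) = (LINT x:A \<union> (space M - A)|M. f x)"
      using sets.sets_into_space[OF A] by (simp add: Un_absorb1)
    also have "\<dots> = (LINT x:A|M. f x) + (LINT x:space M - A|M. f x)"
      using A by (intro set_integral_Un si) auto
    finally show ?case using compl zero[OF B] by simp
  next
    case (union A)
    then have A: "A i \<in> sets M" for i by (auto simp: gen)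
    have "(LINT x:(\<Union>i. A i)|M. f x) = (\<Sum>i. (LINT x:A i|M. f x))"
      using union(1) A by (intro lebesgue_integral_countable_add si)
         (auto simp: disjoint_family_on_def)
    then show ?case using union by simp
  qed (use zero in \<open>auto simp: set_lebesgue_integral_def\<close>)
  let ?P = "{x \<in> space M. 0 < f x}" and ?N = "{x \<in> space M. f x \<le> 0}"
  have "(LINT x|M. \<bar>f x\<bar>) = (LINT x|M. indicator ?P x *\<^sub>R f x - indicator ?N x *\<^sub>R f x)"
    by (intro Bochner_Integration.integral_cong) (auto simp: indicator_def)
  also have "\<dots> = (LINT x:?P|M. f x) - (LINT x:?N|M. f x)"
    unfolding set_lebesgue_integral_def
    by (intro Bochner_Integration.integral_diff si[unfolded set_integrable_def]) auto
  also have "\<dots> = 0" by (simp add: all flip: gen)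
  finally have "AE x in M. \<bar>f x\<bar> = 0"
    using f by (subst (asm) integral_nonneg_eq_0_iff_AE) auto
  then show ?thesis by simp
qed

text \<open>The finite intersections of members of a countable basis do the job; the empty
  intersection contributes \<open>UNIV\<close>.\<close>

lemma borel_countable_Int_stable_generator:
  obtains B :: "'x::second_countable_topology set set"
  where "countable B" "Int_stable B" "UNIV \<in> B" "sets borel = sigma_sets UNIV B"
proof -
  obtain B0 :: "'x set set" where B0: "countable B0" "topological_basis B0"
    using ex_countable_basis by blast
  let ?B = "Inter ` {F. F \<subseteq> B0 \<and> finite F}"
  have "countable ?B"
    using countable_Collect_finite_subset[OF B0(1)] by (simp add: conj_commute)
  moreover have "Int_stable ?B"
  proof (rule Int_stableI_image)
    fix F G assume "F \<in> {F. F \<subseteq> B0 \<and> finite F}" "G \<in> {F. F \<subseteq> B0 \<and> finite F}"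
    then show "\<exists>H\<in>{F. F \<subseteq> B0 \<and> finite F}. \<Inter> F \<inter> \<Inter> G = \<Inter> H"
      by (intro bexI[of _ "F \<union> G"]) auto
  qed
  moreover have "UNIV \<in> ?B" by (rule image_eqI[of _ _ "{}"]) auto
  moreover have "sets borel = sigma_sets UNIV ?B"
  proof
    have "sets borel = sigma_sets UNIV B0"
      unfolding borel_eq_countable_basis[OF B0] by simp
    also have "\<dots> \<subseteq> sigma_sets UNIV ?B"
    proof (rule sigma_sets_mono')
      show "B0 \<subseteq> ?B" by (auto intro!: image_eqI[of _ _ "{b}" for b])
    qed
    finally show "sets borel \<subseteq> sigma_sets UNIV ?B" .
    have "E \<in> sets borel" if "E \<in> ?B" for E
    proof -
      have "open E" using that topological_basis_open[OF B0(2)] by (auto intro!: open_Inter)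
      then show ?thesis by simp
    qed
    then show "sigma_sets UNIV ?B \<subseteq> sets borel"
      using sets.sigma_sets_subset[of ?B borel] by auto
  qed
  ultimately show thesis by (rule that)
qed

text \<open>The family \<open>B\<close> generates only the Borel sets, so \<open>f\<close> is first
  replaced by a Borel function that agrees with it almost everywhere.\<close>

lemma AE_zero_of_set_integral_zero_lebesgue:
  fixes f :: "'x::euclidean_space \<Rightarrow> real"
  assumes f: "integrable lebesgue f"
    and gen: "sets borel = sigma_sets UNIV B" and int: "Int_stable B" and B: "UNIV \<in> B"
    and zero: "\<And>E. E \<in> B \<Longrightarrow> (LINT x:E|lebesgue. f x) = 0"
  shows "AE x in lebesgue. f x = 0"
proof -
  have fm [measurable]: "f \<in> borel_measurable lebesgue" using f by simp
  obtain g where [measurable]: "g \<in> borel_measurable lborel" and fg: "AE x in lborel. f x = g x"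
    using completion_ex_borel_measurable_real[OF fm] by blast
  have fg': "AE x in lebesgue. f x = g x" using fg by (rule AE_completion)
  have [measurable]: "g \<in> borel_measurable lebesgue" by (rule measurable_completion) simp
  have "integrable lebesgue g" using f fg' by (subst (asm) integrable_cong_AE) auto
  then have "integrable lborel g" by (simp add: integrable_completion)
  then have "AE x in lborel. g x = 0"
  proof (rule AE_zero_of_set_integral_zero_generator)
    fix E assume E: "E \<in> B"
    then have Eb: "E \<in> sets borel" by (simp add: gen)
    then have [measurable]: "E \<in> sets lebesgue" by simp
    have "(LINT x:E|lborel. g x) = (LINT x:E|lebesgue. g x)"
      unfolding set_lebesgue_integral_def using Eb
      by (intro integral_completion[symmetric]) auto
    also have "\<dots> = (LINT x:E|lebesgue. f x)"
      unfolding set_lebesgue_integral_def using Eb fg'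
      by (intro integral_cong_AE) auto
    finally show "(LINT x:E|lborel. g x) = 0" using zero[OF E] by simp
  qed (use gen int B in auto)
  then have "AE x in lebesgue. g x = 0" by (rule AE_completion)
  with fg' show ?thesis by eventually_elim simp
qed

text \<open>If \<open>t\<close> exceeds \<open>d\<close>, then \<open>t powr (1 - p)\<close> is at
  most \<open>d powr (1 - p)\<close>, because the exponent is not positive. Integrated over a set of
  finite measure, this serves in place of Hoelder's inequality.\<close>

lemma le_add_powr:
  fixes t d p :: real
  assumes "1 \<le> p" "0 < d" "0 \<le> t"
  shows "t \<le> d + d powr (1 - p) * t powr p"
proof (cases "t \<le> d")
  case False
  then have "t = t powr (1 - p) * t powr p" using assms by (simp flip: powr_add)
  also have "\<dots> \<le> d powr (1 - p) * t powr p"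
    using assms False by (intro mult_right_mono powr_mono2') auto
  finally show ?thesis using assms by simp
qed (use assms in \<open>simp add: add_increasing2\<close>)

lemma Lp_space_set_integrable:
  assumes f: "f \<in> Lp_space M p" and p: "1 \<le> p" and S: "S \<in> fmeasurable M"
  shows "set_integrable M S f"
proof -
  have [measurable]: "f \<in> borel_measurable M" "S \<in> sets M"
    using f S by (auto simp: Lp_space_def)
  have "integrable M (\<lambda>x. indicator S x + norm (f x) powr p)"
    using f S by (auto simp: Lp_space_def fmeasurable_def less_top[symmetric])
  then show ?thesis unfolding set_integrable_def
  proof (rule Bochner_Integration.integrable_bound)
    have "norm (f x) \<le> 1 + norm (f x) powr p" for x
      using le_add_powr[OF p, of 1 "norm (f x)"] by simp
    then show "AE x in M. norm (indicator S x *\<^sub>R f x) \<le> norm (indicator S x + norm (f x) powr p)"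
      by (auto simp: indicator_def)
  qed measurable
qed

text \<open>The parameter \<open>d\<close> stays free: choosing it small first controls the first
  term, and a small mass of the \<open>p\<close>-th power then controls the second.\<close>

lemma set_integral_norm_le_powr:
  assumes f: "f \<in> Lp_space M p" and p: "1 \<le> p" and S: "S \<in> fmeasurable M" and d: "0 < d"
  shows "(LINT x:S|M. norm (f x)) \<le> d * measure M S + d powr (1 - p) * (LINT x:S|M. norm (f x) powr p)"
proof -
  have [measurable]: "f \<in> borel_measurable M" "S \<in> sets M"
    using f S by (auto simp: Lp_space_def)
  have Sd: "set_integrable M S (\<lambda>x. d)"
    using S by (auto simp: set_integrable_def fmeasurable_def less_top[symmetric])
  have Sp: "set_integrable M S (\<lambda>x. norm (f x) powr p)"
    unfolding set_integrable_def
    using f by (intro integrable_mult_indicator) (auto simp: Lp_space_def)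
  have Sq: "set_integrable M S (\<lambda>x. d powr (1 - p) * norm (f x) powr p)"
    using Sp by (intro set_integrable_mult_right)
  have "(LINT x:S|M. norm (f x)) \<le> (LINT x:S|M. d + d powr (1 - p) * norm (f x) powr p)"
  proof (rule set_integral_mono)
    show "set_integrable M S (\<lambda>x. norm (f x))"
      using Lp_space_set_integrable[OF f p S] by (rule set_integrable_norm)
    show "set_integrable M S (\<lambda>x. d + d powr (1 - p) * norm (f x) powr p)"
      using Sd Sq by (rule set_integral_add(1))
  qed (use le_add_powr[OF p d] in auto)
  also have "\<dots> = (LINT x:S|M. d) + d powr (1 - p) * (LINT x:S|M. norm (f x) powr p)"
    using set_integral_add(2)[OF Sd Sq] by simp
  also have "(LINT x:S|M. d) = d * measure M S"
    using S by (simp add: set_lebesgue_integral_def fmeasurable_def)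
  finally show ?thesis .
qed

section \<open>Radial functions on large spheres\<close>

text \<open>The points are taken on a circle in the plane of two basis vectors, with first
  coordinates \<open>0\<close>, \<open>d\<close>, \<open>2 * d\<close> and so on, so that these
  coordinates alone separate them.\<close>

lemma separated_points_on_sphere:
  fixes y :: "'n::euclidean_space"
  assumes dim: "2 \<le> DIM('n)" and d: "0 \<le> d" and y: "real m * d \<le> norm y"
  shows "\<exists>z::nat \<Rightarrow> 'n. (\<forall>j<m. norm (z j) = norm y) \<and> (\<forall>i j. i \<noteq> j \<longrightarrow> d \<le> dist (z i) (z j))"
proof -
  obtain b c :: 'n where bc: "b \<in> Basis" "c \<in> Basis" "b \<noteq> c"
  proof -
    obtain B :: "'n set" where B: "B \<subseteq> Basis \<and> card B = 2"
      using obtain_subset_with_card_n[OF dim] by metis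
    then have "\<exists>b c. B = {b, c} \<and> b \<noteq> c" by (simp only: card_2_iff)
    then obtain b c where "B = {b, c} \<and> b \<noteq> c" by (elim exE)
    with B show ?thesis by (intro that[of b c]) simp_all
  qed
  \<comment> \<open>The radicand is nonnegative for \<open>j < m\<close>, where the norm is
    prescribed. Separation uses only the \<open>b\<close> coordinate and so holds for all
    indices.\<close>
  define z where "z j = (real j * d) *\<^sub>R b + sqrt ((norm y)\<^sup>2 - (real j * d)\<^sup>2) *\<^sub>R c" for j
  have inn: "b \<bullet> b = 1" "c \<bullet> c = 1" "b \<bullet> c = 0" "c \<bullet> b = 0"
    using bc by (auto simp: inner_Basis)
  show ?thesis
  proof (intro exI conjI allI impI)
    fix j assume "j < m"
    then have "real j * d \<le> norm y"
      using y mult_right_mono[of "real j" "real m" d] d by simp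
    then have "(real j * d)\<^sup>2 \<le> (norm y)\<^sup>2" using d by (intro power_mono) auto
    then have rt: "(sqrt ((norm y)\<^sup>2 - (real j * d)\<^sup>2))\<^sup>2 = (norm y)\<^sup>2 - (real j * d)\<^sup>2" by simp
    have "(norm (z j))\<^sup>2 = (real j * d)\<^sup>2 + (sqrt ((norm y)\<^sup>2 - (real j * d)\<^sup>2))\<^sup>2"
      unfolding power2_norm_eq_inner z_def inner_add_left inner_add_right inner_scaleR_left inner_scaleR_right inn
      by (simp add: power2_eq_square)
    then have "(norm (z j))\<^sup>2 = (norm y)\<^sup>2" unfolding rt by simp
    then show "norm (z j) = norm y" by simp
  next
    fix i j :: nat assume "i \<noteq> j"
    have "d = 1 * d" by simp
    also have "\<dots> \<le> \<bar>real i - real j\<bar> * d"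
      using d \<open>i \<noteq> j\<close> by (intro mult_right_mono) auto
    also have "\<dots> = \<bar>(z i - z j) \<bullet> b\<bar>"
      using d by (simp add: z_def inner_diff_left inner_add_left inn left_diff_distrib[symmetric] abs_mult)
    also have "\<dots> \<le> dist (z i) (z j)"
      using Basis_le_norm[OF bc(1), of "z i - z j"] by (simp add: dist_norm)
    finally show "d \<le> dist (z i) (z j)" .
  qed
qed

lemma orthogonal_transformation_dist:
  "orthogonal_transformation T \<Longrightarrow> dist (T x) (T y) = dist x y"
  using orthogonal_transformation_norm[of T "x - y"]
  by (simp add: dist_norm linear_diff[OF orthogonal_transformation_linear])

text \<open>Rotating the ball around the sphere of radius \<open>norm y\<close> yields \<open>m\<close> disjoint balls
  on which the radial function \<open>h\<close> has the same integral.\<close>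

lemma radial_ball_integral_le:
  fixes h :: "real ^ 'n::finite \<Rightarrow> real"
  assumes dim: "2 \<le> CARD('n)" and h: "integrable lebesgue h" and pos: "\<And>x. 0 \<le> h x"
    and radial: "\<And>T. orthogonal_transformation T \<Longrightarrow> AE x in lebesgue. h (T x) = h x"
    and R: "0 \<le> R" and y: "real m * (2 * R) \<le> norm y"
  shows "real m * (LINT x:ball y R|lebesgue. h x) \<le> (LINT x|lebesgue. h x)"
proof -
  have [measurable]: "h \<in> borel_measurable lebesgue" using h by simp
  have DIM: "2 \<le> DIM(real ^ 'n)" using dim by simp
  have R2: "0 \<le> 2 * R" using R by simp
  obtain z :: "nat \<Rightarrow> real ^ 'n"
    where "(\<forall>j<m. norm (z j) = norm y) \<and> (\<forall>i j. i \<noteq> j \<longrightarrow> 2 * R \<le> dist (z i) (z j))"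
    using separated_points_on_sphere[OF DIM R2 y] by (rule exE)
  then have z: "\<And>j. j < m \<Longrightarrow> norm (z j) = norm y"
    and sep: "\<And>i j. i \<noteq> j \<Longrightarrow> 2 * R \<le> dist (z i) (z j)"
    by simp_all
  have int: "integrable lebesgue (\<lambda>x. indicator (ball a R) x * h x)" for a
    using integrable_mult_indicator[OF _ h, of "ball a R"] by simp
  have eq: "(LINT x:ball (z j) R|lebesgue. h x) = (LINT x:ball y R|lebesgue. h x)" if j: "j < m" for j
  proof -
    \<comment> \<open>A rotation taking \<open>y\<close> to \<open>z j\<close> carries the ball
      about \<open>y\<close> onto the ball about \<open>z j\<close>, and by radial symmetry it
      leaves \<open>h\<close> unchanged almost everywhere.\<close>
    obtain T where T: "orthogonal_transformation T" "T y = z j"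
      using orthogonal_transformation_exists[of y "z j"] z[OF j] by metis
    have T_iso: "\<And>x x'. dist (T x) (T x') = dist x x'"
      by (rule orthogonal_transformation_dist[OF T(1)])
    note T_lebesgue = lebesgue_isometry[OF T_iso orthogonal_transformation_surj[OF T(1)]]
    define G where "G x = indicator (ball (z j) R) x * h x" for x
    have G: "G \<in> borel_measurable lebesgue"
      using int unfolding G_def by (rule borel_measurable_integrable)
    have "(LINT x:ball (z j) R|lebesgue. h x) = (LINT x|distr lebesgue lebesgue T. G x)"
      by (simp add: set_lebesgue_integral_def T_lebesgue(2) G_def)
    also have "\<dots> = (LINT x|lebesgue. G (T x))"
      by (rule integral_distr[OF T_lebesgue(1) G])
    also have "\<dots> = (LINT x|lebesgue. indicator (ball y R) x * h x)"
    proof (rule integral_cong_AE)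
      have "indicator (ball (z j) R) (T x) = (indicator (ball y R) x :: real)" for x
        using T_iso[of y x] T(2) by (simp add: indicator_def)
      then show "AE x in lebesgue. G (T x) = indicator (ball y R) x * h x"
        unfolding G_def using radial[OF T(1)] by (auto elim!: eventually_mono)
    qed (use measurable_compose[OF T_lebesgue(1) G] int in \<open>auto dest: borel_measurable_integrable\<close>)
    finally show ?thesis by (simp add: set_lebesgue_integral_def)
  qed
  have disj: "disjoint_family_on (\<lambda>j. ball (z j) R) {..<m}"
  proof -
    have "ball (z i) R \<inter> ball (z j) R = {}" if "i \<noteq> j" for i j
      using sep[OF that] by (intro disjoint_ballI) simp
    then show ?thesis by (auto simp: disjoint_family_on_def)
  qed
  have "real m * (LINT x:ball y R|lebesgue. h x) = (\<Sum>j<m. (LINT x:ball (z j) R|lebesgue. h x))"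
    using eq by simp
  also have "\<dots> = (LINT x|lebesgue. (\<Sum>j<m. indicator (ball (z j) R) x * h x))"
    unfolding set_lebesgue_integral_def real_scaleR_def
    by (intro Bochner_Integration.integral_sum[symmetric] int)
  also have "\<dots> \<le> (LINT x|lebesgue. h x)"
  proof (rule integral_mono)
    \<comment> \<open>By disjointness, at most one of the indicators is nonzero at
      \<open>x\<close>.\<close>
    fix x
    have "(\<Sum>j<m. indicator (ball (z j) R) x * h x) = indicator (\<Union>j<m. ball (z j) R) x * h x"
      by (simp only: indicator_UN_disjoint[OF finite_lessThan disj] sum_distrib_right)
    also have "\<dots> \<le> h x" using pos[of x] by (intro mult_left_le_one_le) (simp_all add: indicator_def)
    finally show "(\<Sum>j<m. indicator (ball (z j) R) x * h x) \<le> h x" .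
    show "integrable lebesgue (\<lambda>x. \<Sum>j<m. indicator (ball (z j) R) x * h x)"
      by (intro Bochner_Integration.integrable_sum int)
  qed (rule h)
  finally show ?thesis .
qed

section \<open>Function spaces imbedded into \<open>L\<^sup>p\<close>\<close>

locale Lp_function_space =
  fixes J :: "'a::real_normed_vector \<Rightarrow> real ^ 'n::finite \<Rightarrow> 'b::{euclidean_space,real_normed_field}"
    and p :: real
  assumes p: "1 \<le> p" and space: "function_space J" and imbedded: "continuously_imbedded_Lp J p"
begin

lemma J_in_Lp: "J u \<in> Lp_space lebesgue p"
  using imbedded by (simp add: continuously_imbedded_Lp_def)

lemma measurable_J [measurable]: "J u \<in> borel_measurable lebesgue"
  using J_in_Lp by (simp add: Lp_space_def)

lemma J_diff: "AE x in lebesgue. J (u - v) x = J u x - J v x"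
proof -
  have "AE x in lebesgue. J (u - v + v) x = J (u - v) x + J v x"
    using space unfolding function_space_def by blast
  then show ?thesis by eventually_elim simp
qed

lemma J_inject:
  assumes "AE x in lebesgue. J u x = J v x"
  shows "u = v"
proof -
  have "AE x in lebesgue. J (u - v) x = 0"
    using assms J_diff[of u v] by eventually_elim simp
  then have "u - v = 0" using space unfolding function_space_def by blast
  then show ?thesis by simp
qed

text \<open>This is the continuity estimate of the imbedding without the root. Enlarging the
  constant to \<open>max C 0\<close> keeps the bound monotone in \<open>norm u\<close>.\<close>

lemma integral_powr_J_le:
  obtains C where "0 \<le> C" "\<And>u. (LINT x|lebesgue. norm (J u x) powr p) \<le> (C * norm u) powr p"
proof -
  obtain C where C: "\<And>u. Lp_norm lebesgue p (J u) \<le> C * norm u"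
    using imbedded by (auto simp: continuously_imbedded_Lp_def)
  show thesis
  proof
    show "0 \<le> max C 0" by simp
    fix u
    let ?I = "LINT x|lebesgue. norm (J u x) powr p"
    have "0 \<le> ?I" by (intro integral_nonneg_AE) auto
    then have "?I = Lp_norm lebesgue p (J u) powr p"
      using p by (simp add: Lp_norm_def powr_powr)
    also have "\<dots> \<le> (max C 0 * norm u) powr p"
    proof (rule powr_mono2)
      show "Lp_norm lebesgue p (J u) \<le> max C 0 * norm u"
        using C[of u] mult_right_mono[of C "max C 0" "norm u"] by simp
    qed (use p in \<open>auto simp: Lp_norm_def\<close>)
    finally show "?I \<le> (max C 0 * norm u) powr p" .
  qed
qed

text \<open>The inner product is the real one on \<open>'b\<close>. With \<open>e\<close> running
  through the basis it tests every real coordinate of the values, in particular real and imaginary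
  parts.\<close>

definition pairing :: "(real ^ 'n) set \<Rightarrow> 'b \<Rightarrow> 'a \<Rightarrow> real" where
  "pairing S e u = (LINT x:S|lebesgue. J u x \<bullet> e)"

lemma set_integrable_J:
  assumes "S \<in> lmeasurable"
  shows "set_integrable lebesgue S (J u)" "set_integrable lebesgue S (\<lambda>x. J u x \<bullet> e)"
proof -
  show "set_integrable lebesgue S (J u)" by (rule Lp_space_set_integrable[OF J_in_Lp p assms])
  then have "integrable lebesgue (\<lambda>x. (indicator S x *\<^sub>R J u x) \<bullet> e)"
    unfolding set_integrable_def by (rule integrable_inner_left)
  then show "set_integrable lebesgue S (\<lambda>x. J u x \<bullet> e)"
    by (simp add: set_integrable_def)
qed

lemma pairing_le:
  assumes S: "S \<in> lmeasurable"
  shows "\<bar>pairing S e u\<bar> \<le> (LINT x:S|lebesgue. norm (J u x)) * norm e"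
proof -
  have "\<bar>pairing S e u\<bar> \<le> (LINT x:S|lebesgue. \<bar>J u x \<bullet> e\<bar>)"
    using set_integral_norm_bound[OF set_integrable_J(2)[OF S]] by (simp add: pairing_def)
  also have "\<dots> \<le> (LINT x:S|lebesgue. norm (J u x) * norm e)"
  proof (rule set_integral_mono)
    show "set_integrable lebesgue S (\<lambda>x. norm (J u x) * norm e)"
      by (intro set_integrable_mult_left set_integrable_norm set_integrable_J(1)[OF S])
    show "set_integrable lebesgue S (\<lambda>x. \<bar>J u x \<bullet> e\<bar>)"
      by (rule set_integrable_abs[OF set_integrable_J(2)[OF S]])
  qed (simp add: Cauchy_Schwarz_ineq2)
  finally show ?thesis by simp
qed

text \<open>The available bound, a measure plus an integral of a \<open>p\<close>-th power, is not
  homogeneous in \<open>u\<close>. It is therefore used for unit vectors, with the free parameter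
  set to 1, and extended by scaling.\<close>

lemma bounded_linear_pairing:
  assumes S: "S \<in> lmeasurable"
  shows "bounded_linear (pairing S e)"
proof -
  have Sm [measurable]: "S \<in> sets lebesgue" using S by (rule fmeasurableD)
  obtain C where C: "0 \<le> C" "\<And>u. (LINT x|lebesgue. norm (J u x) powr p) \<le> (C * norm u) powr p"
    using integral_powr_J_le by blast
  let ?K = "(measure lebesgue S + C powr p) * norm e"
  have add: "pairing S e (u + v) = pairing S e u + pairing S e v" for u v
  proof -
    have ae: "AE x in lebesgue. J (u + v) x = J u x + J v x"
      using space unfolding function_space_def by blast
    have "pairing S e (u + v) = (LINT x:S|lebesgue. J u x \<bullet> e + J v x \<bullet> e)"
      unfolding pairing_def
    proof (rule set_lebesgue_integral_cong_AE)
      show "AE x\<in>S in lebesgue. J (u + v) x \<bullet> e = J u x \<bullet> e + J v x \<bullet> e"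
        using ae by eventually_elim (simp add: inner_add_left)
    qed measurable
    also have "\<dots> = pairing S e u + pairing S e v"
      unfolding pairing_def by (intro set_integral_add(2) set_integrable_J(2) S)
    finally show ?thesis .
  qed
  have scale: "pairing S e (c *\<^sub>R u) = c *\<^sub>R pairing S e u" for c u
  proof -
    have ae: "AE x in lebesgue. J (c *\<^sub>R u) x = c *\<^sub>R J u x"
      using space unfolding function_space_def by blast
    have "pairing S e (c *\<^sub>R u) = (LINT x:S|lebesgue. c * (J u x \<bullet> e))"
      unfolding pairing_def
    proof (rule set_lebesgue_integral_cong_AE)
      show "AE x\<in>S in lebesgue. J (c *\<^sub>R u) x \<bullet> e = c * (J u x \<bullet> e)"
        using ae by eventually_elim simp
    qed measurable
    then show ?thesis by (simp add: pairing_def)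
  qed
  have unit: "\<bar>pairing S e u\<bar> \<le> ?K" if "norm u = 1" for u
  proof -
    have "(LINT x:S|lebesgue. norm (J u x) powr p) \<le> (LINT x|lebesgue. norm (J u x) powr p)"
      unfolding set_lebesgue_integral_def
    proof (rule integral_mono)
      show "integrable lebesgue (\<lambda>x. norm (J u x) powr p)"
        using J_in_Lp by (simp add: Lp_space_def)
      then show "integrable lebesgue (\<lambda>x. indicator S x *\<^sub>R norm (J u x) powr p)"
        by (rule integrable_mult_indicator[OF Sm])
    qed (simp add: indicator_def)
    also have "\<dots> \<le> C powr p" using C(2)[of u] that by simp
    finally have "(LINT x:S|lebesgue. norm (J u x)) \<le> measure lebesgue S + C powr p"
      using set_integral_norm_le_powr[OF J_in_Lp p S zero_less_one, of u] by simp
    then have "(LINT x:S|lebesgue. norm (J u x)) * norm e \<le> ?K"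
      by (rule mult_right_mono) simp
    with pairing_le[OF S, of e u] show ?thesis by simp
  qed
  show ?thesis
  proof (rule bounded_linear_intro[OF add scale])
    fix u
    show "norm (pairing S e u) \<le> norm u * ?K"
    proof (cases "u = 0")
      case True
      then show ?thesis using scale[of 0 0] by simp
    next
      case False
      then have "pairing S e u = norm u * pairing S e (u /\<^sub>R norm u)" by (simp add: scale)
      moreover have "\<bar>pairing S e (u /\<^sub>R norm u)\<bar> \<le> ?K" using False by (intro unit) simp
      ultimately show ?thesis by (simp add: abs_mult mult_left_mono)
    qed
  qed
qed

lemma tendsto_pairing:
  assumes u: "weakly_convergent_to u l" and S: "S \<in> lmeasurable"
  shows "(\<lambda>k. pairing S e (u k)) \<longlonglongrightarrow> pairing S e l"
proof -
  have "blinfun_apply (Blinfun (pairing S e)) = pairing S e"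
    by (rule bounded_linear_Blinfun_apply[OF bounded_linear_pairing[OF S]])
  moreover have "(\<lambda>k. blinfun_apply (Blinfun (pairing S e)) (u k)) \<longlonglongrightarrow> blinfun_apply (Blinfun (pairing S e)) l"
    using u unfolding weakly_convergent_to_def by (rule spec)
  ultimately show ?thesis by simp
qed

text \<open>Truncating a countable intersection-stable generator of the Borel sets by balls of
  integer radius gives bounded test sets, on which every \<open>J u\<close> is integrable. If all
  pairings vanish, each coordinate of \<open>J u\<close> vanishes almost everywhere on each of these
  balls.\<close>

lemma countable_total_pairings:
  obtains I where "countable I" "\<And>S e. (S, e) \<in> I \<Longrightarrow> S \<in> lmeasurable \<and> bounded S"
    "\<And>u. (\<And>S e. (S, e) \<in> I \<Longrightarrow> pairing S e u = 0) \<Longrightarrow> u = 0"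
proof -
  obtain B :: "(real ^ 'n) set set" where B: "countable B" "Int_stable B" "UNIV \<in> B"
    and gen: "sets borel = sigma_sets UNIV B"
    using borel_countable_Int_stable_generator by blast
  let ?I = "(\<lambda>(E, m::nat). E \<inter> cball 0 (real m)) ` (B \<times> UNIV) \<times> (Basis :: 'b set)"
  show thesis
  proof
    show "countable ?I" using B(1) by (intro countable_SIGMA countable_image) (auto intro: countable_finite)
    show "S \<in> lmeasurable \<and> bounded S" if SI: "(S, e) \<in> ?I" for S e
    proof -
      obtain E m where "E \<in> B" and S: "S = E \<inter> cball 0 (real m)" using SI by auto
      then have "E \<in> sets borel" by (simp add: gen)
      then have "S \<in> sets lebesgue" using S by auto
      moreover have "bounded S" using S by auto
      ultimately show ?thesis by (simp add: bounded_set_imp_lmeasurable)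
    qed
    fix u assume zero: "\<And>S e. (S, e) \<in> ?I \<Longrightarrow> pairing S e u = 0"
    have "AE x in lebesgue. indicator (cball 0 (real m)) x *\<^sub>R (J u x \<bullet> e) = 0"
      if "e \<in> Basis" for m :: nat and e
    proof (rule AE_zero_of_set_integral_zero_lebesgue[OF _ gen B(2,3)])
      show "integrable lebesgue (\<lambda>x. indicator (cball 0 (real m)) x *\<^sub>R (J u x \<bullet> e))"
        using set_integrable_J(2)[of "cball 0 (real m)"] by (simp add: set_integrable_def)
      fix E assume "E \<in> B"
      then have "pairing (E \<inter> cball 0 (real m)) e u = 0" using \<open>e \<in> Basis\<close> by (intro zero) auto
      then show "(LINT x:E|lebesgue. indicator (cball 0 (real m)) x *\<^sub>R (J u x \<bullet> e)) = 0"
        by (simp add: pairing_def set_lebesgue_integral_def indicator_inter_arith mult.assoc)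
    qed
    then have "AE x in lebesgue. \<forall>m::nat. \<forall>e\<in>Basis. indicator (cball 0 (real m)) x *\<^sub>R (J u x \<bullet> e) = 0"
      by (intro AE_all_countable[THEN iffD2] allI AE_finite_allI finite_Basis)
    then have "AE x in lebesgue. J u x = 0"
    proof eventually_elim
      case (elim x)
      obtain m :: nat where "norm x \<le> real m" using real_arch_simple by blast
      then have "J u x \<bullet> e = 0" if "e \<in> Basis" for e
        using elim[rule_format, OF that, of m] by simp
      then show ?case by (simp add: euclidean_eq_iff[of "J u x"])
    qed
    then show "u = 0" using space unfolding function_space_def by blast
  qed
qed

end

section \<open>Isometries acting on pairings and on radial functions\<close>

lemma lmeasurable_vimage_isometry:
  fixes T :: "'a::euclidean_space \<Rightarrow> 'a"
  assumes iso: "\<And>x y. dist (T x) (T y) = dist x y" and surj: "surj T" and S: "S \<in> lmeasurable"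
  shows "T -` S \<in> lmeasurable"
proof -
  note T = lebesgue_isometry[OF iso surj]
  have "T -` S \<in> sets lebesgue"
    using measurable_sets[OF T(1) fmeasurableD[OF S]] by simp
  moreover have "emeasure lebesgue (T -` S) = emeasure lebesgue S"
    using emeasure_distr[OF T(1) fmeasurableD[OF S]] T(2) by simp
  ultimately show ?thesis
    using fmeasurableD2[OF S] by (intro fmeasurableI) (simp_all only: less_top[symmetric] infinity_ennreal_def not_False_eq_True)
qed

lemma AE_lebesgue_isometry:
  fixes T :: "'a::euclidean_space \<Rightarrow> 'a"
  assumes iso: "\<And>x y. dist (T x) (T y) = dist x y" and surj: "surj T" and P: "AE x in lebesgue. P x"
  shows "AE x in lebesgue. P (T x)"
proof (rule AE_distrD[OF lebesgue_isometry(1)[OF iso surj]])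
  show "AE x in distr lebesgue lebesgue T. P x"
    unfolding lebesgue_isometry(2)[OF iso surj] by (rule P)
qed

context Lp_function_space
begin

text \<open>A change of variables moves the isometry from the function to the test set, which
  becomes the image of \<open>S\<close> under \<open>T\<close>, written as a preimage under
  \<open>inv T\<close>.\<close>

lemma pairing_isometry:
  assumes iso: "\<And>x y. dist (T x) (T y) = dist x y" and surj: "surj T"
    and ae: "AE x in lebesgue. J w x = J u (T x)" and S: "S \<in> lmeasurable"
  shows "inv T -` S \<in> lmeasurable" "pairing S e w = pairing (inv T -` S) e u"
proof -
  note T = lebesgue_isometry[OF iso surj]
  note [measurable] = T(1)
  have "inj T" using iso by (metis injI dist_eq_0_iff)
  then have inv_T: "inv T (T x) = x" for x by simp
  have [measurable]: "S \<in> sets lebesgue" using S by (rule fmeasurableD)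
  show "inv T -` S \<in> lmeasurable"
  proof (rule lmeasurable_vimage_isometry[OF _ _ S])
    show "dist (inv T x) (inv T y) = dist x y" for x y
      using iso[of "inv T x" "inv T y"] surj_f_inv_f[OF surj] by simp
    show "surj (inv T)" using \<open>inj T\<close> by (rule inj_imp_surj_inv)
  qed
  then have [measurable]: "inv T -` S \<in> sets lebesgue" by (rule fmeasurableD)
  have "pairing S e w = (LINT x|lebesgue. indicator (inv T -` S) (T x) * (J u (T x) \<bullet> e))"
    unfolding pairing_def set_lebesgue_integral_def
  proof (rule integral_cong_AE)
    show "AE x in lebesgue. indicator S x *\<^sub>R (J w x \<bullet> e) = indicator (inv T -` S) (T x) * (J u (T x) \<bullet> e)"
      using ae by eventually_elim (simp add: indicator_def inv_T)
  qed measurable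
  also have "\<dots> = (LINT x|distr lebesgue lebesgue T. indicator (inv T -` S) x * (J u x \<bullet> e))"
    by (rule integral_distr[symmetric, OF T(1)]) measurable
  also have "\<dots> = pairing (inv T -` S) e u"
    by (simp add: T(2) pairing_def set_lebesgue_integral_def)
  finally show "pairing S e w = pairing (inv T -` S) e u" .
qed

lemma radial_subspace_diff:
  assumes "u \<in> radial_subspace J" "v \<in> radial_subspace J"
  shows "u - v \<in> radial_subspace J"
  unfolding radial_subspace_def
proof (intro CollectI allI impI)
  fix T :: "real ^ 'n \<Rightarrow> real ^ 'n" assume T: "orthogonal_transformation T"
  have "AE x in lebesgue. J (u - v) (T x) = J u (T x) - J v (T x)"
    using orthogonal_transformation_dist[OF T] orthogonal_transformation_surj[OF T] J_diff
    by (rule AE_lebesgue_isometry)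
  moreover have "AE x in lebesgue. J u (T x) = J u x" "AE x in lebesgue. J v (T x) = J v x"
    using assms T by (auto simp: radial_subspace_def)
  ultimately show "AE x in lebesgue. J (u - v) (T x) = J (u - v) x"
    using J_diff[of u v] by eventually_elim simp
qed

text \<open>Rotation invariance provides \<open>w\<close> representing the rotated \<open>l\<close>.
  For each \<open>u k\<close>, pairing with a test set or with its rotated image gives the same
  value; in the limit the same holds for \<open>l\<close>, so all pairings of \<open>w\<close> and
  \<open>l\<close> agree.\<close>

lemma radial_subspace_weakly_closed:
  assumes inv: "\<And>T. orthogonal_transformation T \<Longrightarrow> invariant_under J T"
    and u: "\<And>k. u k \<in> radial_subspace J" and lim: "weakly_convergent_to u l"
  shows "l \<in> radial_subspace J"
  unfolding radial_subspace_def
proof (intro CollectI allI impI)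
  fix T :: "real ^ 'n \<Rightarrow> real ^ 'n" assume T: "orthogonal_transformation T"
  have T_iso: "\<And>x y. dist (T x) (T y) = dist x y" and surj: "surj T"
    using orthogonal_transformation_dist[OF T] orthogonal_transformation_surj[OF T] by blast+
  obtain w where w: "AE x in lebesgue. J w x = J l (T x)"
    using inv[OF T] unfolding invariant_under_def by blast
  obtain I where I: "\<And>S e. (S, e) \<in> I \<Longrightarrow> S \<in> lmeasurable \<and> bounded S"
    "\<And>u. (\<And>S e. (S, e) \<in> I \<Longrightarrow> pairing S e u = 0) \<Longrightarrow> u = 0"
    using countable_total_pairings by metis
  have "w - l = 0"
  proof (rule I(2))
    fix S e assume "(S, e) \<in> I"
    then have S: "S \<in> lmeasurable" using I(1) by blast
    have "pairing S e (u k) = pairing (inv T -` S) e (u k)" for k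
    proof (rule pairing_isometry(2)[OF T_iso surj _ S])
      have "AE x in lebesgue. J (u k) (T x) = J (u k) x"
        using u T by (auto simp: radial_subspace_def)
      then show "AE x in lebesgue. J (u k) x = J (u k) (T x)" by eventually_elim simp
    qed
    then have "(\<lambda>k. pairing S e (u k)) \<longlonglongrightarrow> pairing (inv T -` S) e l"
      using tendsto_pairing[OF lim pairing_isometry(1)[OF T_iso surj w S]] by simp
    then have "pairing (inv T -` S) e l = pairing S e l"
      using tendsto_pairing[OF lim S] by (rule LIMSEQ_unique)
    then show "pairing S e (w - l) = 0"
      using pairing_isometry(2)[OF T_iso surj w S]
      by (simp add: linear_diff bounded_linear.linear[OF bounded_linear_pairing[OF S]])
  qed
  with w show "AE x in lebesgue. J l (T x) = J l x" by (auto elim!: eventually_mono)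
qed

text \<open>The part of \<open>w\<close> on \<open>S\<close> is a part of \<open>v\<close> on a ball
  far from the origin. This ball is one of \<open>m\<close> disjoint balls carrying equal mass, so
  it carries at most a fraction \<open>1 / m\<close> of the total. The threshold \<rho> is uniform
  over all radial \<open>v\<close> with norm at most \<open>A\<close>.\<close>

lemma radial_shift_integral_small:
  assumes dim: "2 \<le> CARD('n)" and S: "S \<in> lmeasurable" "bounded S" and \<epsilon>: "0 < \<epsilon>"
  shows "\<exists>\<rho>. \<forall>v w y. v \<in> radial_subspace J \<longrightarrow> norm v \<le> A \<longrightarrow> \<rho> \<le> norm y \<longrightarrow>
    (AE x in lebesgue. J w x = J v (x - y)) \<longrightarrow> (LINT x:S|lebesgue. norm (J w x)) \<le> \<epsilon>"
proof -
  have Sm [measurable]: "S \<in> sets lebesgue" using S(1) by (rule fmeasurableD)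
  obtain R where R: "0 < R" "S \<subseteq> ball 0 R"
    using S(2) by (metis bounded_subset_ballD)
  obtain C where C: "0 \<le> C" "\<And>u. (LINT x|lebesgue. norm (J u x) powr p) \<le> (C * norm u) powr p"
    using integral_powr_J_le by blast
  define K where "K = (C * A) powr p"
  \<comment> \<open>With this \<open>d\<close> the term containing the measure of \<open>S\<close>
    is at most half of \<epsilon>; the added 1 avoids division by zero. Then \<open>m\<close> is
    chosen to make the other term at most the other half, where \<open>K\<close> bounds the total
    mass.\<close>
  define d where "d = \<epsilon> / (2 * (measure lebesgue S + 1))"
  have d: "0 < d" and dS: "d * measure lebesgue S \<le> \<epsilon> / 2"
    using \<epsilon> by (auto simp: d_def field_simps add_pos_nonneg intro!: divide_pos_pos)
  obtain m :: nat where m: "2 * (d powr (1 - p) * K) / \<epsilon> < real m" using reals_Archimedean2 by blast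
  have "0 \<le> K" by (simp add: K_def)
  then have "0 \<le> 2 * (d powr (1 - p) * K) / \<epsilon>" using \<epsilon> by simp
  with m have m0: "0 < real m" by linarith
  show ?thesis
  proof (intro exI[of _ "real m * (2 * R)"] allI impI)
    fix v w y
    assume v: "v \<in> radial_subspace J" "norm v \<le> A" and y: "real m * (2 * R) \<le> norm y"
      and ae: "AE x in lebesgue. J w x = J v (x - y)"
    let ?h = "\<lambda>x. norm (J v x) powr p" and ?T = "\<lambda>x. x - y"
    have h: "integrable lebesgue ?h" using J_in_Lp by (simp add: Lp_space_def)
    have w: "integrable lebesgue (\<lambda>x. norm (J w x) powr p)" using J_in_Lp by (simp add: Lp_space_def)
    have T_iso: "dist (?T x) (?T x') = dist x x'" for x x' by (simp add: dist_norm)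
    have "surj ?T" by (rule surjI[of _ "\<lambda>x. x + y"]) simp
    note T = lebesgue_isometry[of ?T, OF T_iso this]
    \<comment> \<open>Because \<open>w\<close> is \<open>v\<close> shifted by \<open>y\<close>, the
      ball about the origin for \<open>w\<close> corresponds to the ball about \<open>- y\<close>
      for \<open>v\<close>, whose centre also has norm \<open>norm y\<close>.\<close>
    define G where "G x = indicator (ball (- y) R) x * ?h x" for x
    have ind: "integrable lebesgue (\<lambda>x. indicator (ball a R) x * f x)"
      if "integrable lebesgue f" for a and f :: "real ^ 'n \<Rightarrow> real"
      using integrable_mult_indicator[OF _ that, of "ball a R"] by simp
    have G: "G \<in> borel_measurable lebesgue"
      using ind[OF h] unfolding G_def by (rule borel_measurable_integrable)
    have "(LINT x:S|lebesgue. norm (J w x) powr p)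
        \<le> (LINT x|lebesgue. indicator (ball 0 R) x * norm (J w x) powr p)"
      unfolding set_lebesgue_integral_def
    proof (rule integral_mono)
      show "integrable lebesgue (\<lambda>x. indicator S x *\<^sub>R norm (J w x) powr p)"
        using w by (rule integrable_mult_indicator[OF Sm])
      show "integrable lebesgue (\<lambda>x. indicator (ball 0 R) x * norm (J w x) powr p)"
        by (rule ind[OF w])
    qed (use R(2) in \<open>auto simp: indicator_def\<close>)
    also have "\<dots> = (LINT x|lebesgue. G (?T x))"
    proof (rule integral_cong_AE)
      show "AE x in lebesgue. indicator (ball 0 R) x * norm (J w x) powr p = G (?T x)"
        using ae by eventually_elim (simp add: G_def indicator_def dist_norm norm_minus_commute)
    qed (use ind[OF w] measurable_compose[OF T(1) G] in \<open>auto dest: borel_measurable_integrable\<close>)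
    also have "\<dots> = (LINT x|distr lebesgue lebesgue ?T. G x)"
      by (rule integral_distr[symmetric, OF T(1) G])
    also have "\<dots> = (LINT x:ball (- y) R|lebesgue. ?h x)"
      by (simp add: T(2) G_def set_lebesgue_integral_def)
    finally have 1: "(LINT x:S|lebesgue. norm (J w x) powr p) \<le> (LINT x:ball (- y) R|lebesgue. ?h x)" .
    have "real m * (LINT x:S|lebesgue. norm (J w x) powr p) \<le> real m * (LINT x:ball (- y) R|lebesgue. ?h x)"
      using 1 by (rule mult_left_mono) simp
    also have "\<dots> \<le> (LINT x|lebesgue. ?h x)"
    proof (rule radial_ball_integral_le[OF dim h])
      fix T :: "real ^ 'n \<Rightarrow> real ^ 'n" assume "orthogonal_transformation T"
      then have "AE x in lebesgue. J v (T x) = J v x" using v(1) by (simp add: radial_subspace_def)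
      then show "AE x in lebesgue. ?h (T x) = ?h x" by eventually_elim simp
    qed (use R y in auto)
    also have "\<dots> \<le> (C * norm v) powr p" by (rule C(2))
    also have "\<dots> \<le> K"
      unfolding K_def using C(1) v(2) p by (intro powr_mono2 mult_left_mono) auto
    finally have 2: "(LINT x:S|lebesgue. norm (J w x) powr p) \<le> K / real m"
      using m0 by (simp add: pos_le_divide_eq mult.commute)
    have "(LINT x:S|lebesgue. norm (J w x)) \<le> d * measure lebesgue S + d powr (1 - p) * (K / real m)"
      using set_integral_norm_le_powr[OF J_in_Lp p S(1) d, of w]
        mult_left_mono[OF 2, of "d powr (1 - p)"] by simp
    also have "\<dots> \<le> \<epsilon> / 2 + \<epsilon> / 2"
    proof (rule add_mono[OF dS])
      show "d powr (1 - p) * (K / real m) \<le> \<epsilon> / 2" using m m0 \<epsilon> by (simp add: field_simps)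
    qed
    finally show "(LINT x:S|lebesgue. norm (J w x)) \<le> \<epsilon>" by simp
  qed
qed

text \<open>For large shifts the pairing is small by radial symmetry; the remaining shifts take finitely
  many values, and for each of them weak convergence applies.\<close>

lemma tendsto_pairing_shift:
  assumes dim: "2 \<le> CARD('n)" and S: "S \<in> lmeasurable" "bounded S"
    and v: "\<And>k. v k \<in> radial_subspace J" "\<And>k. norm (v k) \<le> A" "weakly_convergent_to v 0"
    and y: "\<And>r. finite (range y \<inter> cball 0 r)"
    and z: "\<And>k. AE x in lebesgue. J (z k) x = J (v k) (x - y k)"
  shows "(\<lambda>k. pairing S e (z k)) \<longlonglongrightarrow> 0"
proof (rule LIMSEQ_I)
  fix \<epsilon> :: real assume \<epsilon>: "0 < \<epsilon>"
  \<comment> \<open>The added 1 makes the product with \<open>norm e\<close> strictly less than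
    \<epsilon>, also for \<open>e = 0\<close>.\<close>
  let ?\<delta> = "\<epsilon> / (norm e + 1)"
  have "0 < norm e + 1" by (simp add: add_nonneg_pos)
  then have \<delta>: "0 < ?\<delta>" "?\<delta> * norm e < \<epsilon>" using \<epsilon> by (auto simp: field_simps)
  obtain \<rho> where \<rho>: "\<forall>v w y. v \<in> radial_subspace J \<longrightarrow> norm v \<le> A \<longrightarrow> \<rho> \<le> norm y \<longrightarrow>
      (AE x in lebesgue. J w x = J v (x - y)) \<longrightarrow> (LINT x:S|lebesgue. norm (J w x)) \<le> ?\<delta>"
    using radial_shift_integral_small[OF dim S \<delta>(1)] by (rule exE)
  let ?T = "\<lambda>a x::real ^ 'n. x - a"
  have T_iso: "dist (?T a x) (?T a x') = dist x x'" for a x x' by (simp add: dist_norm)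
  have surj: "surj (?T a)" for a by (rule surjI[of _ "\<lambda>x. x + a"]) simp
  have "\<forall>\<^sub>F k in sequentially. \<forall>a\<in>range y \<inter> cball 0 \<rho>. \<bar>pairing (inv (?T a) -` S) e (v k)\<bar> < \<epsilon>"
  proof (rule eventually_ball_finite[OF y], rule ballI)
    fix a assume "a \<in> range y \<inter> cball 0 \<rho>"
    \<comment> \<open>Writing \<open>a\<close> as an actual shift \<open>y j\<close> supplies the
      element \<open>z j\<close> representing the shifted function, as
      \<open>pairing_isometry\<close> requires. The test set then stays fixed while \<open>k\<close>
      varies in \<open>v k\<close>.\<close>
    then obtain j where j: "a = y j" by auto
    have m: "inv (?T a) -` S \<in> lmeasurable"
      unfolding j using pairing_isometry(1)[OF T_iso surj z S(1)] .
    have "pairing (inv (?T a) -` S) e 0 = 0"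
      using bounded_linear.linear[OF bounded_linear_pairing[OF m]] by (rule linear_0)
    then have "(\<lambda>k. pairing (inv (?T a) -` S) e (v k)) \<longlonglongrightarrow> 0"
      using tendsto_pairing[OF v(3) m, of e] by simp
    from tendstoD[OF this \<epsilon>]
    show "\<forall>\<^sub>F k in sequentially. \<bar>pairing (inv (?T a) -` S) e (v k)\<bar> < \<epsilon>" by simp
  qed
  then have "\<forall>\<^sub>F k in sequentially. \<bar>pairing S e (z k)\<bar> < \<epsilon>"
  proof eventually_elim
    case (elim k)
    show ?case
    proof (cases "\<rho> \<le> norm (y k)")
      case True
      have "\<bar>pairing S e (z k)\<bar> \<le> (LINT x:S|lebesgue. norm (J (z k) x)) * norm e"
        by (rule pairing_le[OF S(1)])
      also have "\<dots> \<le> ?\<delta> * norm e"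
        by (intro mult_right_mono \<rho>[rule_format, OF v(1,2) True z]) simp
      finally show ?thesis using \<delta>(2) by simp
    next
      case False
      then show ?thesis
        using elim pairing_isometry(2)[OF T_iso surj z S(1), of e k] by auto
    qed
  qed
  then show "\<exists>n0. \<forall>k\<ge>n0. norm (pairing S e (z k) - 0) < \<epsilon>"
    by (simp add: eventually_sequentially)
qed

end

section \<open>Lattice points and compactness of the imbedding\<close>

lemma finite_lattice_cball: "finite ({y :: real ^ 'n. \<forall>i. y $ i \<in> \<int>} \<inter> cball 0 r)"
proof (rule finite_imageD)
  let ?L = "{y :: real ^ 'n. \<forall>i. y $ i \<in> \<int>} \<inter> cball 0 r"
  \<comment> \<open>Each coordinate is an integer of absolute value at most \<open>r\<close>, which
    leaves finitely many coordinate functions.\<close>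
  have "($) ` ?L \<subseteq> PiE UNIV (\<lambda>_. {k \<in> \<int>. \<bar>k\<bar> \<le> r})"
    by (auto simp: PiE_UNIV_domain intro: order_trans[OF component_le_norm_cart])
  then show "finite (($) ` ?L)"
    by (rule finite_subset) (intro finite_PiE finite_abs_int_segment finite)
  show "inj_on ($) ?L" by (rule inj_onI) (simp add: vec_eq_iff)
qed

theorem theorem6p1:
  fixes J :: "'a::banach \<Rightarrow> real ^ 'n \<Rightarrow> 'b::{euclidean_space,real_normed_field}"
    and p :: real
  assumes dim: "2 \<le> CARD('n)"
    and p: "1 < p"
    and space: "function_space J"
    and reflexive: "reflexive_space TYPE('a)"
    and cocompact: "cocompactly_imbedded_Lp (lattice_shifts J) J p"
    and ae_subseq: "\<And>u l. weakly_convergent_to u l \<Longrightarrow>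
      \<exists>r :: nat \<Rightarrow> nat. strict_mono r \<and> (AE x in lebesgue. convergent (\<lambda>k. J (u (r k)) x))"
    and shift_invariant: "\<And>y. invariant_under J (\<lambda>x. x + y)"
    and rotation_invariant: "\<And>\<omega>. orthogonal_transformation \<omega> \<Longrightarrow> invariant_under J \<omega>"
  shows "compactly_imbedded_Lp (radial_subspace J) J p"
  unfolding compactly_imbedded_Lp_def
proof (intro allI impI, elim conjE)
  fix u :: "nat \<Rightarrow> 'a"
  assume "\<forall>k. u k \<in> radial_subspace J" and bdd: "bounded (range u)"
  then have rad: "\<And>k. u k \<in> radial_subspace J" by blast
  interpret Lp_function_space J p
    using p space cocompact by unfold_locales (auto simp: cocompactly_imbedded_Lp_def)
  obtain I where I: "countable I" "\<And>S e. (S, e) \<in> I \<Longrightarrow> S \<in> lmeasurable \<and> bounded S"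
    "\<And>u. (\<And>S e. (S, e) \<in> I \<Longrightarrow> pairing S e u = 0) \<Longrightarrow> u = 0"
    using countable_total_pairings by metis
  \<comment> \<open>Packaged as bounded functionals, the pairings fit the abstract weak convergence
    lemmas. \<open>Blinfun\<close> is meaningful here for indices in \<open>I\<close>, whose test
    sets have finite measure.\<close>
  define l where "l i = Blinfun (pairing (fst i) (snd i))" for i
  have l: "blinfun_apply (l i) = pairing (fst i) (snd i)" if "i \<in> I" for i
    unfolding l_def using I(2)[of "fst i" "snd i"] that
    by (intro bounded_linear_Blinfun_apply bounded_linear_pairing) simp
  have total: "x = 0" if "\<And>i. i \<in> I \<Longrightarrow> blinfun_apply (l i) x = 0" for x
    using that l by (intro I(3)) fastforce
  obtain r w where r: "strict_mono (r :: nat \<Rightarrow> nat)" and w: "weakly_convergent_to (\<lambda>k. u (r k)) w"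
    using weakly_convergent_subsequence_of_total[OF reflexive bdd I(1) total] by blast
  define v where "v k = u (r k) - w" for k
  have "w \<in> radial_subspace J"
    using rotation_invariant rad w by (rule radial_subspace_weakly_closed)
  then have v_rad: "v k \<in> radial_subspace J" for k
    unfolding v_def using rad by (intro radial_subspace_diff)
  have v_lim: "weakly_convergent_to v 0"
    using w by (simp add: weakly_convergent_to_def v_def blinfun.diff_right LIM_zero_iff)
  obtain A where A: "\<And>k. norm (u k) \<le> A" using bdd by (auto simp: bounded_iff)
  then have v_bdd: "norm (v k) \<le> A + norm w" for k
    unfolding v_def using norm_triangle_ineq4[of "u (r k)" w] A[of "r k"] by linarith
  have "D_weakly_convergent_to (lattice_shifts J) (\<lambda>k. u (r k)) w"
    unfolding D_weakly_convergent_to_def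
  proof (intro allI impI)
    fix g :: "nat \<Rightarrow> 'a \<Rightarrow> 'a" assume "\<forall>k. g k \<in> lattice_shifts J"
    then obtain y where y: "\<And>k i. y k $ i \<in> \<int>"
      and g: "\<And>k x. AE t in lebesgue. J (g k x) t = J x (t - y k)"
      unfolding lattice_shifts_def by simp metis
    define z where "z k = g k (v k)" for k
    \<comment> \<open>The operator \<open>g k\<close> is known only through its values almost
      everywhere. Shift invariance gives an element with the same values and the norm of
      \<open>v k\<close>, and injectivity of \<open>J\<close> identifies it with
      \<open>z k\<close>.\<close>
    have "norm (z k) = norm (v k)" for k
    proof -
      obtain x where x: "AE t in lebesgue. J x t = J (v k) (t + - y k)" "norm x = norm (v k)"
        using shift_invariant[of "- y k"] unfolding invariant_under_def by blast
      have "AE t in lebesgue. J (z k) t = J x t"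
        using x(1) g[of k "v k"] unfolding z_def by eventually_elim simp
      then have "z k = x" by (rule J_inject)
      with x(2) show ?thesis by simp
    qed
    then have z_bdd: "bounded (range z)" using v_bdd by (auto simp: bounded_iff)
    have y_fin: "finite (range y \<inter> cball 0 \<rho>)" for \<rho>
      by (rule finite_subset[OF _ finite_lattice_cball[of \<rho>]]) (use y in auto)
    have "(\<lambda>k. l i (z k)) \<longlonglongrightarrow> l i 0" if i: "i \<in> I" for i
    proof -
      have S: "fst i \<in> lmeasurable" "bounded (fst i)" using I(2)[of "fst i" "snd i"] i by simp_all
      have "(\<lambda>k. pairing (fst i) (snd i) (z k)) \<longlonglongrightarrow> 0"
        using tendsto_pairing_shift[OF dim S v_rad v_bdd v_lim y_fin g] unfolding z_def .
      moreover have "pairing (fst i) (snd i) 0 = 0"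
        using blinfun.zero_right[of "l i"] by (simp add: l[OF i])
      ultimately show ?thesis by (simp add: l[OF i])
    qed
    \<comment> \<open>Boundedness of \<open>z\<close> and reflexivity turn convergence on the total
      family of pairings into weak convergence.\<close>
    then have "weakly_convergent_to z 0"
      by (intro weakly_convergent_to_of_total[OF reflexive z_bdd total])
    moreover have "z = (\<lambda>k. g k (u (r k) - w))" by (simp add: z_def v_def fun_eq_iff)
    ultimately show "weakly_convergent_to (\<lambda>k. g k (u (r k) - w)) 0" by simp
  qed
  then have "Lp_convergent lebesgue p (\<lambda>k. J (u (r k)))"
    using cocompact unfolding cocompactly_imbedded_Lp_def by blast
  with r show "\<exists>r :: nat \<Rightarrow> nat. strict_mono r \<and> Lp_convergent lebesgue p (\<lambda>k. J (u (r k)))"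
    by blast
qed

end
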